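(* Let $(X,d)$ be a compact metric space, let $f:X\to X$ be a continuous surjection, and let $\mathbb{F}=(f_n)_{n\in\mathbb{N}}$ be a sequence of feeble open continuous surjections $f_n:X\to X$ such that $f_n\circ f=f\circ f_n$ for every $n\in\mathbb{N}$. If $\sum_{n=1}^{\infty} D(f_n,f)<\infty$, then $(X,f)$ is weakly mixing if and only if $(X,\mathbb{F})$ is weakly mixing.
   Context: $D(g,h)=\sup_{x\in X}d(g(x),h(x))$ for continuous self maps $g,h$ of $X$. A map $g:X\to X$ is feeble open if $\mathrm{int}(g(U))\neq\emptyset$ for every non-empty open $U\subset X$. For $\mathbb{F}=(f_n)_{n\in\mathbb{N}}$ (with $\mathbb{N}=\{1,2,\dots\}$), put $\omega_n=f_n\circ f_{n-1}\circ\cdots\circ f_1$; $(X,\mathbb{F})$ denotes the non-autonomous system with orbits $\{\omega_n(x):n\in\mathbb{N}\}$. $(X,\mathbb{F})$ is weakly mixing if for all non-empty open sets $U_1,U_2,V_1,V_2\subset X$ there is $n\in\mathbb{N}$ with $\omega_n(U_i)\cap V_i\neq\emptyset$ for $i=1,2$. $(X,f)$ is weakly mixing if the same holds with $\omega_n$ replaced by $f^n$. *)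

theory Defs
  imports "HOL-Analysis.Analysis"
begin

(* Taken in the reals; it is the true supremum of the distances whenever these are bounded,
   in particular for all maps on a compact space. *)
definition sup_dist :: "('a::metric_space \<Rightarrow> 'a) \<Rightarrow> ('a \<Rightarrow> 'a) \<Rightarrow> real"
  where "sup_dist g h = (SUP x. dist (g x) (h x))"

definition feeble_open :: "('a::topological_space \<Rightarrow> 'a) \<Rightarrow> bool"
  where "feeble_open g \<longleftrightarrow> (\<forall>U. open U \<and> U \<noteq> {} \<longrightarrow> interior (g ` U) \<noteq> {})"

(* F n is the n-th map for n = 1, 2, ...; the value F 0 is never used. *)
primrec omega :: "(nat \<Rightarrow> 'a \<Rightarrow> 'a) \<Rightarrow> nat \<Rightarrow> 'a \<Rightarrow> 'a"
  where
    "omega F 0 = id"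
  | "omega F (Suc n) = F (Suc n) \<circ> omega F n"

definition weakly_mixing_nonautonomous :: "(nat \<Rightarrow> 'a::topological_space \<Rightarrow> 'a) \<Rightarrow> bool"
  where "weakly_mixing_nonautonomous F \<longleftrightarrow>
    (\<forall>U1 U2 V1 V2.
      open U1 \<and> U1 \<noteq> {} \<and> open U2 \<and> U2 \<noteq> {} \<and> open V1 \<and> V1 \<noteq> {} \<and> open V2 \<and> V2 \<noteq> {} \<longrightarrow>
      (\<exists>n\<ge>1. omega F n ` U1 \<inter> V1 \<noteq> {} \<and> omega F n ` U2 \<inter> V2 \<noteq> {}))"

definition weakly_mixing :: "('a::topological_space \<Rightarrow> 'a) \<Rightarrow> bool"
  where "weakly_mixing f \<longleftrightarrow>
    (\<forall>U1 U2 V1 V2.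
      open U1 \<and> U1 \<noteq> {} \<and> open U2 \<and> U2 \<noteq> {} \<and> open V1 \<and> V1 \<noteq> {} \<and> open V2 \<and> V2 \<noteq> {} \<longrightarrow>
      (\<exists>n\<ge>1. (f ^^ n) ` U1 \<inter> V1 \<noteq> {} \<and> (f ^^ n) ` U2 \<inter> V2 \<noteq> {}))"

end

(* Since f commutes with every F n, the composition of F (r+1), ..., F (r+k) stays within
   D(F (r+1), f) + ... + D(F (r+k), f) of f ^^ k, uniformly in k; for large r this is arbitrarily
   small. A weak mixing time k of f for the sets interior (omega F r ` U) and slightly shrunken V
   thus gives the time r + k for F. Conversely, a time n > r of F for the sets omega F r -` U gives
   the time n - r for f. Such n exists: unless X is a point, weak mixing excludes isolated points,
   so U and V can be shrunk to prevent any visit up to time r. *)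
theory Submission
  imports Defs
begin

section \<open>Uniform distance, compositions along the sequence, and their approximation by
  iterates of f\<close>

lemma dist_le_sup_dist:
  assumes "bounded (UNIV :: 'a::metric_space set)"
  shows "dist (g x) (h x) \<le> sup_dist g (h :: 'a \<Rightarrow> 'a)"
proof -
  obtain B where "\<And>x y :: 'a. dist x y \<le> B"
    using assms bounded_two_points by (metis UNIV_I)
  then have "bdd_above (range (\<lambda>x. dist (g x) (h x)))"
    by (intro bdd_aboveI2)
  then show ?thesis
    unfolding sup_dist_def by (rule cSUP_upper2[where x = x]) auto
qed

lemma sup_dist_nonneg:
  assumes "bounded (UNIV :: 'a::metric_space set)"
  shows "0 \<le> sup_dist g (h :: 'a \<Rightarrow> 'a)"
  using dist_le_sup_dist[OF assms] zero_le_dist order_trans by blast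

text \<open>\<open>omega\<close> never reads index 0, so the shifted sequence
  \<open>\<lambda>i. F (r + i)\<close> begins with \<open>F (r + 1)\<close>, and no map is repeated
  or skipped where the two blocks meet.\<close>

lemma omega_add: "omega F (r + k) = omega (\<lambda>i. F (r + i)) k \<circ> omega F r"
  by (induction k) (auto simp: comp_assoc)

lemma omega_commute:
  assumes "\<And>n. n \<ge> 1 \<Longrightarrow> F n \<circ> f = f \<circ> F n"
  shows "omega F k (f x) = f (omega F k x)"
proof (induction k)
  case (Suc k)
  then show ?case
    using assms[of "Suc k"] by (simp add: fun_eq_iff)
qed simp

lemma continuous_on_omega:
  assumes "\<And>n. n \<ge> 1 \<Longrightarrow> continuous_on UNIV (F n)"
  shows "continuous_on UNIV (omega F k)"
proof (induction k)
  case (Suc k)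
  then show ?case
    unfolding omega.simps
    by (intro continuous_on_compose continuous_on_subset[OF assms]) auto
qed (simp add: id_def)

lemma surj_omega:
  assumes "\<And>n. n \<ge> 1 \<Longrightarrow> surj (F n)"
  shows "surj (omega F k)"
proof (induction k)
  case (Suc k)
  then show ?case
    unfolding omega.simps by (rule comp_surj) (simp add: assms)
qed simp

text \<open>The image under \<open>h\<close> need not be open, so \<open>g\<close> is applied to its
  interior, which is again open and nonempty.\<close>

lemma feeble_open_comp:
  assumes "feeble_open g" "feeble_open h"
  shows "feeble_open (g \<circ> h)"
  unfolding feeble_open_def
proof (intro allI impI)
  fix U :: "'a set"
  assume "open U \<and> U \<noteq> {}"
  then have "interior (g ` interior (h ` U)) \<noteq> {}"
    using assms unfolding feeble_open_def by auto
  moreover have "g ` interior (h ` U) \<subseteq> (g \<circ> h) ` U"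
    using interior_subset[of "h ` U"] by auto
  ultimately show "interior ((g \<circ> h) ` U) \<noteq> {}"
    using interior_mono by blast
qed

lemma feeble_open_omega:
  assumes "\<And>n. n \<ge> 1 \<Longrightarrow> feeble_open (F n)"
  shows "feeble_open (omega F k)"
proof (induction k)
  case 0
  then show ?case by (simp add: feeble_open_def interior_open)
next
  case (Suc k)
  then show ?case
    unfolding omega.simps by (intro feeble_open_comp assms) auto
qed

text \<open>The triangle inequality is applied with the intermediate point
  \<open>f (omega F k x) = omega F k (f x)\<close>; this way no modulus of continuity of \<open>f\<close> enters.\<close>
lemma dist_omega_funpow_le:
  fixes f :: "'a::metric_space \<Rightarrow> 'a"
  assumes bdd: "bounded (UNIV :: 'a set)"
    and comm: "\<And>n. n \<ge> 1 \<Longrightarrow> F n \<circ> f = f \<circ> F n"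
  shows "dist (omega F k x) ((f ^^ k) x) \<le> (\<Sum>i<k. sup_dist (F (Suc i)) f)"
proof (induction k arbitrary: x)
  case (Suc k)
  have "dist (omega F (Suc k) x) ((f ^^ Suc k) x)
      \<le> dist (F (Suc k) (omega F k x)) (f (omega F k x)) + dist (omega F k (f x)) ((f ^^ k) (f x))"
    using dist_triangle[of _ _ "f (omega F k x)"] omega_commute[of F f, OF comm]
    by (simp add: funpow_swap1)
  also have "\<dots> \<le> sup_dist (F (Suc k)) f + (\<Sum>i<k. sup_dist (F (Suc i)) f)"
    by (intro add_mono dist_le_sup_dist[OF bdd] Suc.IH)
  finally show ?case by simp
qed simp

text \<open>Since the terms are nonnegative, one tail of the series bounds all the finite sums at
  once. Hence \<open>r\<close> can be fixed before \<open>k\<close>; this order matters because weak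
  mixing supplies \<open>k\<close> only for sets that already depend on \<open>r\<close>.\<close>

lemma omega_shift_approximates_funpow:
  fixes f :: "'a::metric_space \<Rightarrow> 'a"
  assumes bdd: "bounded (UNIV :: 'a set)"
    and comm: "\<And>n. n \<ge> 1 \<Longrightarrow> F n \<circ> f = f \<circ> F n"
    and sm: "summable (\<lambda>n. sup_dist (F (Suc n)) f)"
    and "\<epsilon> > 0"
  obtains r where "\<And>k x. dist (omega (\<lambda>i. F (r + i)) k x) ((f ^^ k) x) < \<epsilon>"
proof -
  obtain r where r: "norm (\<Sum>i. sup_dist (F (Suc (i + r))) f) < \<epsilon>"
    using suminf_exist_split[OF \<open>\<epsilon> > 0\<close> sm] by blast
  have "dist (omega (\<lambda>i. F (r + i)) k x) ((f ^^ k) x) < \<epsilon>" for k x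
  proof -
    have "dist (omega (\<lambda>i. F (r + i)) k x) ((f ^^ k) x) \<le> (\<Sum>i<k. sup_dist (F (r + Suc i)) f)"
      by (rule dist_omega_funpow_le[OF bdd]) (simp add: comm)
    also have "\<dots> = (\<Sum>i<k. sup_dist (F (Suc (i + r))) f)"
      by (simp add: add.commute)
    also have "\<dots> \<le> (\<Sum>i. sup_dist (F (Suc (i + r))) f)"
      using summable_ignore_initial_segment[OF sm, of r] sup_dist_nonneg[OF bdd]
      by (intro sum_le_suminf) auto
    finally show ?thesis using r by simp
  qed
  then show ?thesis by (rule that)
qed

section \<open>Isolated points and late visiting times\<close>

lemma weakly_mixing_nonautonomousD:
  assumes "weakly_mixing_nonautonomous F"
    and "open U1" "U1 \<noteq> {}" "open U2" "U2 \<noteq> {}" "open V1" "V1 \<noteq> {}" "open V2" "V2 \<noteq> {}"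
  obtains n where "n \<ge> 1" "omega F n ` U1 \<inter> V1 \<noteq> {}" "omega F n ` U2 \<inter> V2 \<noteq> {}"
  using that assms(1)[unfolded weakly_mixing_nonautonomous_def, rule_format, of U1 U2 V1 V2] assms(2-) by auto

lemma weakly_mixingD:
  assumes "weakly_mixing f"
    and "open U1" "U1 \<noteq> {}" "open U2" "U2 \<noteq> {}" "open V1" "V1 \<noteq> {}" "open V2" "V2 \<noteq> {}"
  obtains n where "n \<ge> 1" "(f ^^ n) ` U1 \<inter> V1 \<noteq> {}" "(f ^^ n) ` U2 \<inter> V2 \<noteq> {}"
  using that assms(1)[unfolded weakly_mixing_def, rule_format, of U1 U2 V1 V2] assms(2-) by auto

text \<open>Use the open singleton for both source sets: at the common time its image is a single
  point, which cannot meet two disjoint targets.\<close>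

lemma weakly_mixing_nonautonomous_not_isolated:
  fixes F :: "nat \<Rightarrow> 'a::t2_space \<Rightarrow> 'a"
  assumes wm: "weakly_mixing_nonautonomous F" and "a \<noteq> (b :: 'a)"
  shows "\<not> open {p :: 'a}"
proof
  assume p: "open {p}"
  obtain A B where "open A" "open B" "a \<in> A" "b \<in> B" and disj: "A \<inter> B = {}"
    using hausdorff[OF \<open>a \<noteq> b\<close>] by blast
  then have A: "open A" "A \<noteq> {}" and B: "open B" "B \<noteq> {}" by auto
  obtain n where "omega F n ` {p} \<inter> A \<noteq> {}" "omega F n ` {p} \<inter> B \<noteq> {}"
    by (rule weakly_mixing_nonautonomousD[OF wm p _ p _ A B]) auto
  then show False using disj by auto
qed

lemma weakly_mixing_nonautonomous_late_time:
  fixes F :: "nat \<Rightarrow> 'a::metric_space \<Rightarrow> 'a"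
  assumes wm: "weakly_mixing_nonautonomous F"
    and cont: "\<And>n. n \<ge> 1 \<Longrightarrow> continuous_on UNIV (F n)"
    and ab: "a \<noteq> (b :: 'a)"
    and U1: "open U1" "U1 \<noteq> {}" and U2: "open U2" "U2 \<noteq> {}"
    and V1: "open V1" "V1 \<noteq> {}" and V2: "open V2" "V2 \<noteq> {}"
  obtains n where "n > r" "omega F n ` U1 \<inter> V1 \<noteq> {}" "omega F n ` U2 \<inter> V2 \<noteq> {}"
proof -
  obtain u where u: "u \<in> U1" using U1 by blast
  define S where "S = (\<lambda>n. omega F n u) ` {..r}"
  have finS: "finite S" unfolding S_def by simp
  \<comment> \<open>If \<open>V1\<close> lay inside the finite set \<open>S\<close>, deleting all
    points of \<open>S\<close> other than \<open>v\<close> would leave the open singleton of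
    \<open>v\<close>.\<close>
  have "\<not> V1 \<subseteq> S"
  proof
    assume sub: "V1 \<subseteq> S"
    obtain v where v: "v \<in> V1" using V1 by blast
    have "open (V1 - (S - {v}))"
      using V1 finS by (intro open_Diff finite_imp_closed) auto
    moreover have "V1 - (S - {v}) = {v}" using sub v by auto
    ultimately show False
      using weakly_mixing_nonautonomous_not_isolated[OF wm ab] by simp
  qed
  then obtain v where v: "v \<in> V1" "v \<notin> S" by blast
  obtain d where d: "d > 0" "\<And>x. x \<in> S \<Longrightarrow> d \<le> dist v x"
    using finite_set_avoid[OF finS, of v] v(2) by metis
  \<comment> \<open>At every time up to \<open>r\<close>, \<open>U\<close> stays within d/2 of the
    orbit point of \<open>u\<close>, which is at distance at least \<open>d\<close> from
    \<open>v\<close>, so it misses \<open>V\<close>. Shrinking only the first pair is enough because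
    the visiting time is common to both pairs.\<close>
  define U where "U = U1 \<inter> (\<Inter>n\<in>{..r}. omega F n -` ball (omega F n u) (d/2))"
  define V where "V = V1 \<inter> ball v (d/2)"
  have "open U" unfolding U_def
    using U1 continuous_on_omega[of F, OF cont]
    by (intro open_Int open_INT ballI open_vimage) auto
  moreover have "U \<noteq> {}" unfolding U_def using u d by auto
  moreover have "open V" "V \<noteq> {}" unfolding V_def using V1 v d by auto
  ultimately obtain n where n: "omega F n ` U \<inter> V \<noteq> {}" "omega F n ` U2 \<inter> V2 \<noteq> {}"
    by (rule weakly_mixing_nonautonomousD[OF wm _ _ U2 _ _ V2])
  have "n > r"
  proof (rule ccontr)
    assume "\<not> n > r"
    then have le: "n \<le> r" by simp
    obtain x where x: "x \<in> U" "omega F n x \<in> V" using n(1) by auto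
    have "dist (omega F n u) (omega F n x) < d/2"
      using x(1) le unfolding U_def by auto
    moreover have "dist v (omega F n x) < d/2"
      using x(2) unfolding V_def by auto
    ultimately have "dist v (omega F n u) < d"
      using dist_triangle_half_l[of v "omega F n x" d "omega F n u"] by simp
    moreover have "d \<le> dist v (omega F n u)"
      using d(2) le unfolding S_def by auto
    ultimately show False by simp
  qed
  moreover have "omega F n ` U1 \<inter> V1 \<noteq> {}"
    using n(1) unfolding U_def V_def by blast
  ultimately show ?thesis using n(2) that by blast
qed

section \<open>Transfer of visits between the two systems\<close>

lemma open_pair_contains_balls:
  fixes V1 V2 :: "'a::metric_space set"
  assumes "open V1" "V1 \<noteq> {}" "open V2" "V2 \<noteq> {}"
  obtains \<epsilon> v1 v2 where "\<epsilon> > 0" "ball v1 (2 * \<epsilon>) \<subseteq> V1" "ball v2 (2 * \<epsilon>) \<subseteq> V2"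
proof -
  obtain v1 v2 where v: "v1 \<in> V1" "v2 \<in> V2" using assms by blast
  then obtain e1 e2 where e: "e1 > 0" "ball v1 e1 \<subseteq> V1" "e2 > 0" "ball v2 e2 \<subseteq> V2"
    using assms by (meson openE)
  show ?thesis
  proof (rule that)
    show "min e1 e2 / 2 > 0" using e by simp
    \<comment> \<open>The radius is doubled to leave room for an error: a visit to the inner ball of
      radius \<epsilon> by one system becomes a visit to the ball of radius 2\<epsilon> by the
      other.\<close>
    show "ball v1 (2 * (min e1 e2 / 2)) \<subseteq> V1" "ball v2 (2 * (min e1 e2 / 2)) \<subseteq> V2"
      using e by auto
  qed
qed

lemma mem_ball_double:
  assumes "y \<in> ball v \<epsilon>" "dist y z < \<epsilon>"
  shows "z \<in> ball v (2 * \<epsilon>)"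
  using assms dist_triangle[of v z y] by simp

theorem proposition6:
  fixes f :: "'a::metric_space \<Rightarrow> 'a"
    and F :: "nat \<Rightarrow> 'a \<Rightarrow> 'a"
  assumes "compact (UNIV :: 'a set)"
    and "continuous_on UNIV f" and "surj f"
    and "\<And>n. n \<ge> 1 \<Longrightarrow> feeble_open (F n)"
    and "\<And>n. n \<ge> 1 \<Longrightarrow> continuous_on UNIV (F n)"
    and "\<And>n. n \<ge> 1 \<Longrightarrow> surj (F n)"
    and "\<And>n. n \<ge> 1 \<Longrightarrow> F n \<circ> f = f \<circ> F n"
    and "summable (\<lambda>n. sup_dist (F (Suc n)) f)"
  shows "weakly_mixing f \<longleftrightarrow> weakly_mixing_nonautonomous F"
proof
  note approx = omega_shift_approximates_funpow[OF compact_imp_bounded[OF assms(1)] assms(7,8)]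
  show "weakly_mixing_nonautonomous F" if wm: "weakly_mixing f"
    unfolding weakly_mixing_nonautonomous_def
  proof (intro allI impI, elim conjE)
    fix U1 U2 V1 V2 :: "'a set"
    assume U: "open U1" "U1 \<noteq> {}" "open U2" "U2 \<noteq> {}"
      and V: "open V1" "V1 \<noteq> {}" "open V2" "V2 \<noteq> {}"
    obtain \<epsilon> v1 v2 where \<epsilon>: "\<epsilon> > 0" "ball v1 (2 * \<epsilon>) \<subseteq> V1" "ball v2 (2 * \<epsilon>) \<subseteq> V2"
      using open_pair_contains_balls[OF V] .
    obtain r where r: "\<And>k x. dist (omega (\<lambda>i. F (r + i)) k x) ((f ^^ k) x) < \<epsilon>"
      using approx[OF _ \<epsilon>(1)] by blast
    \<comment> \<open>Feeble openness provides the nonempty open source sets at time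
      \<open>r\<close> to which weak mixing of \<open>f\<close> is applied.\<close>
    have int: "interior (omega F r ` U1) \<noteq> {}" "interior (omega F r ` U2) \<noteq> {}"
      using feeble_open_omega[of F r, OF assms(4)] U unfolding feeble_open_def by auto
    obtain k where k: "k \<ge> 1" "(f ^^ k) ` interior (omega F r ` U1) \<inter> ball v1 \<epsilon> \<noteq> {}"
        "(f ^^ k) ` interior (omega F r ` U2) \<inter> ball v2 \<epsilon> \<noteq> {}"
      by (rule weakly_mixingD[OF wm open_interior int(1) open_interior int(2)
            open_ball[of v1 \<epsilon>] _ open_ball[of v2 \<epsilon>]]) (use \<epsilon>(1) in auto)
    have hit: "omega F (r + k) ` U \<inter> V \<noteq> {}"
      if meets: "(f ^^ k) ` interior (omega F r ` U) \<inter> ball v \<epsilon> \<noteq> {}"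
        and "ball v (2 * \<epsilon>) \<subseteq> V" for U V v
    proof -
      obtain u where u: "u \<in> U" "(f ^^ k) (omega F r u) \<in> ball v \<epsilon>"
        using meets interior_subset[of "omega F r ` U"] by blast
      have "dist ((f ^^ k) (omega F r u)) (omega F (r + k) u) < \<epsilon>"
        using r[of k "omega F r u"] by (simp add: omega_add dist_commute)
      then have "omega F (r + k) u \<in> ball v (2 * \<epsilon>)"
        by (rule mem_ball_double[OF u(2)])
      then show ?thesis using u(1) that by blast
    qed
    show "\<exists>n\<ge>1. omega F n ` U1 \<inter> V1 \<noteq> {} \<and> omega F n ` U2 \<inter> V2 \<noteq> {}"
      using hit[OF k(2) \<epsilon>(2)] hit[OF k(3) \<epsilon>(3)] k(1) by (intro exI[of _ "r + k"]) auto
  qed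
  show "weakly_mixing f" if wm: "weakly_mixing_nonautonomous F"
  proof (cases "\<exists>a b :: 'a. a \<noteq> b")
    \<comment> \<open>In a one-point space the late-time argument breaks down, since the point is
      isolated; but every nonempty set is then the whole space and time 1 works.\<close>
    case False
    then have eq: "x = y" for x y :: 'a by blast
    have UNIV: "U = UNIV" if ne: "U \<noteq> {}" for U :: "'a set"
    proof -
      obtain x where "x \<in> U" using ne by blast
      then have "y \<in> U" for y using eq[of x y] by simp
      then show ?thesis by blast
    qed
    have "(f ^^ 1) ` U \<inter> V \<noteq> {}" if "U \<noteq> {}" "V \<noteq> {}" for U V
      using UNIV[OF that(2)] that(1) by simp
    then show ?thesis
      unfolding weakly_mixing_def by (meson le_refl)
  next
    case True
    then obtain a b :: 'a where ab: "a \<noteq> b" by blast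
    show ?thesis
      unfolding weakly_mixing_def
    proof (intro allI impI, elim conjE)
      fix U1 U2 V1 V2 :: "'a set"
      assume U: "open U1" "U1 \<noteq> {}" "open U2" "U2 \<noteq> {}"
        and V: "open V1" "V1 \<noteq> {}" "open V2" "V2 \<noteq> {}"
      obtain \<epsilon> v1 v2 where \<epsilon>: "\<epsilon> > 0" "ball v1 (2 * \<epsilon>) \<subseteq> V1" "ball v2 (2 * \<epsilon>) \<subseteq> V2"
        using open_pair_contains_balls[OF V] .
      obtain r where r: "\<And>k x. dist (omega (\<lambda>i. F (r + i)) k x) ((f ^^ k) x) < \<epsilon>"
        using approx[OF _ \<epsilon>(1)] by blast
      \<comment> \<open>Pulling back by \<open>omega F r\<close> makes the orbit pass through
        \<open>U\<close> at time \<open>r\<close>; the remaining \<open>n - r\<close> steps are then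
        compared with \<open>f\<close>. Surjectivity keeps the preimage nonempty.\<close>
      have pre: "open (omega F r -` U)" "omega F r -` U \<noteq> {}" if "open U" "U \<noteq> {}" for U
        using open_vimage[OF that(1) continuous_on_omega[of F, OF assms(5)]]
          surj_omega[of F r, OF assms(6)] that(2) by (auto simp: surj_vimage_empty)
      obtain n where n: "n > r" "omega F n ` (omega F r -` U1) \<inter> ball v1 \<epsilon> \<noteq> {}"
          "omega F n ` (omega F r -` U2) \<inter> ball v2 \<epsilon> \<noteq> {}"
        by (rule weakly_mixing_nonautonomous_late_time[of F a b "omega F r -` U1" "omega F r -` U2"
              "ball v1 \<epsilon>" "ball v2 \<epsilon>" r, OF wm assms(5) ab pre[OF U(1,2)] pre[OF U(3,4)]])
          (use \<epsilon>(1) in auto)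
      define k where "k = n - r"
      \<comment> \<open>The strict inequality \<open>n > r\<close> is what makes \<open>k\<close> an
        admissible time for \<open>f\<close>.\<close>
      have k: "n = r + k" "k \<ge> 1"
        using n(1) by (simp_all add: k_def)
      have hit: "(f ^^ k) ` U \<inter> V \<noteq> {}"
        if meets: "omega F n ` (omega F r -` U) \<inter> ball v \<epsilon> \<noteq> {}"
          and "ball v (2 * \<epsilon>) \<subseteq> V" for U V v
      proof -
        obtain u where u: "omega F r u \<in> U" "omega F n u \<in> ball v \<epsilon>"
          using meets by blast
        have "dist (omega F n u) ((f ^^ k) (omega F r u)) < \<epsilon>"
          using r[of k "omega F r u"] by (simp add: omega_add k(1))
        then have "(f ^^ k) (omega F r u) \<in> ball v (2 * \<epsilon>)"
          by (rule mem_ball_double[OF u(2)])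
        then show ?thesis using u(1) that by blast
      qed
      show "\<exists>n\<ge>1. (f ^^ n) ` U1 \<inter> V1 \<noteq> {} \<and> (f ^^ n) ` U2 \<inter> V2 \<noteq> {}"
        using hit[OF n(2) \<epsilon>(2)] hit[OF n(3) \<epsilon>(3)] k(2) by blast
    qed
  qed
qed

end
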